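(* Let $\lambda$ be an infinite cardinal number. Suppose that $X$ is either $\ell_\infty(\lambda)$ or $\ell_\infty^c(\lambda)$. Then $$\{T\in \mathscr{B}(X)\colon T\text{ is not bounded below on any copy of }X\} = \{T\in \mathscr{B}(X)\colon I_X\neq ATB\text{ for all }A,B\in \mathscr{B}(X)\},$$ and this set, denoted $\mathscr{S}_X(X)$, is the unique maximal ideal of $\mathscr{B}(X)$.
   Context: Banach spaces are over a fixed scalar field, either $\mathbb{R}$ or $\mathbb{C}$. For an infinite cardinal $\lambda$, $\ell_\infty(\lambda)$ is the Banach space of bounded scalar-valued functions on $\lambda$ with the supremum norm, and $\ell_\infty^c(\lambda)$ is its closed subspace of all $z\in\ell_\infty(\lambda)$ with $z(\alpha)\neq 0$ for at most countably many $\alpha<\lambda$ (so $\ell_\infty^c(\omega)=\ell_\infty$). $\mathscr{B}(X)$ is the Banach algebra of bounded linear operators on $X$, $I_X$ is the identity operator, and ideals are two-sided. An operator $T$ is bounded below if there is $c>0$ with $\|Tx\|\geqslant c\|x\|$ for all $x$ in its domain. $T$ is bounded below on a copy of a Banach space $E$ if there is a subspace $E_0$ of the domain of $T$ such that $E_0$ is isomorphic (linearly homeomorphic) to $E$ and $T|_{E_0}$ is bounded below. *)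

theory Defs
  imports
    "HOL-Analysis.Analysis"
    "HOL-Probability.Discrete_Topology"
    "HOL-Algebra.Ideal"
begin

text \<open>
  A cardinal \<open>\<lambda>\<close> is represented by a type \<open>'i\<close> of that cardinality. Giving \<open>'i\<close> the discrete topology
  makes every function on it continuous, so the type below consists of all bounded functions
  \<open>\<lambda> \<rightarrow> 'k\<close>, and its library norm is the supremum norm.
\<close>

type_synonym ('i, 'k) linf = "'i discrete \<Rightarrow>\<^sub>C 'k"

text \<open>
  The library has only the real vector space structure on this type. Multiplication by
  scalars from \<open>'k\<close>, to be instantiated by \<open>real\<close> and \<open>complex\<close>, is added here.
\<close>

unbundle bcontfun.lifting

lift_definition linf_scale :: "'k::real_normed_field \<Rightarrow> ('i, 'k) linf \<Rightarrow> ('i, 'k) linf"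
    (infixr \<open>*\<^sub>K\<close> 75)
  is "\<lambda>c z \<alpha>. c * z \<alpha>"
  using bounded_linear_image[OF _ bounded_linear_mult_right]
  by (fastforce simp: bcontfun_def image_image intro!: continuous_intros)

interpretation linf: vector_space linf_scale
  by standard (transfer, simp add: fun_eq_iff algebra_simps)+

definition ell_inf :: "('i, 'k::real_normed_field) linf set" where
  "ell_inf = UNIV"

definition ell_inf_c :: "('i, 'k::real_normed_field) linf set" where
  "ell_inf_c = {z. countable {\<alpha>. apply_bcontfun z \<alpha> \<noteq> 0}}"

definition linear_on ::
    "('i, 'k::real_normed_field) linf set \<Rightarrow> (('i, 'k) linf \<Rightarrow> ('j, 'k) linf) \<Rightarrow> bool" where
  "linear_on E f \<longleftrightarrow>
     (\<forall>x\<in>E. \<forall>y\<in>E. f (x + y) = f x + f y) \<and> (\<forall>c. \<forall>x\<in>E. f (c *\<^sub>K x) = c *\<^sub>K f x)"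

text \<open>
  The ring of bounded linear operators on a subspace \<open>X\<close>. Operators are
  extensional (\<open>undefined\<close> outside \<open>X\<close>), so that equality in the carrier is equality of maps on \<open>X\<close>.
\<close>

definition bounded_operators ::
    "('i, 'k::real_normed_field) linf set \<Rightarrow> (('i, 'k) linf \<Rightarrow> ('i, 'k) linf) set" where
  "bounded_operators X =
     {T \<in> X \<rightarrow>\<^sub>E X. linear_on X T \<and> (\<exists>C. \<forall>x\<in>X. norm (T x) \<le> C * norm x)}"

definition operator_algebra ::
    "('i, 'k::real_normed_field) linf set \<Rightarrow> (('i, 'k) linf \<Rightarrow> ('i, 'k) linf) ring" where
  "operator_algebra X =
     \<lparr>carrier = bounded_operators X,
      mult = compose X,
      one = (\<lambda>x\<in>X. x),
      zero = (\<lambda>x\<in>X. 0),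
      add = (\<lambda>S T. \<lambda>x\<in>X. S x + T x)\<rparr>"

definition isomorphic_spaces ::
    "('i, 'k::real_normed_field) linf set \<Rightarrow> ('j, 'k) linf set \<Rightarrow> bool" where
  "isomorphic_spaces E F \<longleftrightarrow> (\<exists>f g. linear_on E f \<and> homeomorphism E F f g)"

definition bounded_below_on ::
    "('i, 'k::real_normed_field) linf set \<Rightarrow> (('i, 'k) linf \<Rightarrow> ('i, 'k) linf) \<Rightarrow> bool" where
  "bounded_below_on E T \<longleftrightarrow> (\<exists>c>0. \<forall>x\<in>E. norm (T x) \<ge> c * norm x)"

definition bounded_below_on_copy ::
    "('i, 'k::real_normed_field) linf set \<Rightarrow> (('i, 'k) linf \<Rightarrow> ('i, 'k) linf)
      \<Rightarrow> ('j, 'k) linf set \<Rightarrow> bool" where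
  "bounded_below_on_copy X T E \<longleftrightarrow>
     (\<exists>E0\<subseteq>X. linf.subspace E0 \<and> isomorphic_spaces E E0 \<and> bounded_below_on E0 T)"

definition singular_operators ::
    "('i, 'k::real_normed_field) linf set \<Rightarrow> (('i, 'k) linf \<Rightarrow> ('i, 'k) linf) set" where
  "singular_operators X =
     {T \<in> carrier (operator_algebra X). \<not> bounded_below_on_copy X T X}"

text \<open>
  Ideals of the ring are the same as ideals of the algebra, since the ring is unital and
  \<open>c T = (c I) T\<close>.
\<close>

definition unique_maximal_ideal :: "'a set \<Rightarrow> 'a ring \<Rightarrow> bool" where
  "unique_maximal_ideal J R \<longleftrightarrow> maximalideal J R \<and> (\<forall>J'. maximalideal J' R \<longrightarrow> J' = J)"

end

theory Submission
  imports Defs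
begin

text \<open>
  Write \<open>X\<close> for the space and \<open>\<lambda>\<close> for the cardinality of the index set. Everything follows from one
  fact: if an operator \<open>T\<close> on \<open>X\<close> satisfies \<open>\<parallel>T e\<parallel> \<ge> \<delta> > 0\<close> for all unit vectors \<open>e\<close>
  (the indicator functions of single indices), then the identity of \<open>X\<close> factors as \<open>A T B\<close> (\<open>identity_factors_through_large_on_unit_vectors\<close>). For each unit vector one
  coordinate of its image is large; Rosenthal's lemma (\<open>rosenthal_lemma\<close>) thins the index set to a
  subset of the same cardinality on which the corresponding coordinate functionals hardly
  interact; on the thinned set \<open>T\<close>, followed by the choice of these coordinates and a
  rescaling, is a small perturbation of the identity, hence invertible
  (\<open>near_identity_left_invertible\<close>).

  An operator that is bounded below on a copy of \<open>X\<close> becomes, after composition with the isomorphism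
  onto the copy, bounded below on the unit vectors; so the identity factors through it. The converse
  is elementary, and the two sets of operators coincide (\<open>bounded_below_on_copy_iff\<close>).

  If the identity factors through \<open>S + T\<close>, say \<open>A S B + A T B = I\<close>, then each unit vector has an image of norm
  at least \<open>1 / 2\<close> under one of the two summands. One summand is large on \<open>\<lambda>\<close> many unit vectors,
  so the identity factors through it (\<open>identity_factors_through_summand\<close>). Hence the operators through
  which the identity does not factor are closed under addition, and they then form the
  greatest proper ideal for purely algebraic reasons (\<open>unique_maximal_ideal_of_nonfactors\<close>).

  The argument uses only coordinatewise constructions which keep countable supports countable.
  It is therefore carried out in a locale that covers both spaces and both scalar fields.
\<close>

section \<open>Rosenthal's disjointification lemma\<close>

text \<open>
  The total variation of a finitely additive measure is the motivating example. Superadditivity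
  is stable under restriction to a subset and under pulling back along an injection, and it is
  all that the combinatorics below uses.
\<close>

definition bounded_superadditive :: "real \<Rightarrow> ('a set \<Rightarrow> real) \<Rightarrow> bool" where
  "bounded_superadditive M v \<longleftrightarrow>
     (\<forall>A. 0 \<le> v A \<and> v A \<le> M) \<and> (\<forall>A B. A \<inter> B = {} \<longrightarrow> v A + v B \<le> v (A \<union> B))"

lemma bounded_superadditive_mono:
  assumes "bounded_superadditive M v" "A \<subseteq> B"
  shows "v A \<le> v B"
proof -
  have "v A + v (B - A) \<le> v (A \<union> (B - A))" "0 \<le> v (B - A)"
    using assms(1) unfolding bounded_superadditive_def by blast+
  then show ?thesis
    using assms(2) by (simp add: Un_absorb1)
qed

lemma bounded_superadditive_finite_atoms:
  assumes v: "bounded_superadditive M v" and "0 < \<delta>"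
  shows "finite {a. \<delta> \<le> v {a}}"
proof (rule ccontr)
  assume inf: "infinite {a. \<delta> \<le> v {a}}"
  obtain n :: nat where n: "M / \<delta> < n"
    using reals_Archimedean2 by blast
  obtain F where F: "finite F" "card F = n" "F \<subseteq> {a. \<delta> \<le> v {a}}"
    using infinite_arbitrarily_large[OF inf] by blast
  have "card F * \<delta> \<le> v F"
    using F(1,3)
  proof (induction F)
    case empty
    then show ?case using v by (simp add: bounded_superadditive_def)
  next
    case (insert a F)
    then have "v {a} + v F \<le> v ({a} \<union> F)"
      using v unfolding bounded_superadditive_def by blast
    with insert show ?case by (simp add: algebra_simps)
  qed
  also have "v F \<le> M"
    using v by (simp add: bounded_superadditive_def)
  finally show False
    using n F(2) \<open>0 < \<delta>\<close> by (simp add: field_simps)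
qed

text \<open>
  Kupka's argument. Partition the index set into as many rows as it has elements, each row as
  large as the whole set. If some row has the required property, it is the range sought.
  Otherwise every row contains a point whose set function gives more than \<open>\<epsilon>\<close> to the rest of
  that row. The set of these points meets each row only once, so on it each of the chosen set
  functions has lost more than \<open>\<epsilon>\<close> of its total mass. This can be repeated at most \<open>M / \<epsilon>\<close> times.
\<close>

theorem rosenthal_lemma:
  fixes v :: "'a \<Rightarrow> 'a set \<Rightarrow> real"
  assumes inf: "infinite (UNIV :: 'a set)" and "0 < \<epsilon>"
    and v: "\<And>a. bounded_superadditive M (v a)"
  obtains h :: "'a \<Rightarrow> 'a" where "inj h" "\<And>a. v (h a) (range h - {h a}) \<le> \<epsilon>"
proof -
  \<comment> \<open>The infinite cardinal \<open>\<lambda>\<close> satisfies \<open>\<lambda> \<cdot> \<lambda> = \<lambda>\<close>; the rows are the images of the lines \<open>{a} \<times> UNIV\<close>.\<close>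
  obtain p :: "'a \<times> 'a \<Rightarrow> 'a" where p: "inj p"
    using card_of_Times_same_infinite[OF inf]
    unfolding card_of_ordIso[symmetric] bij_betw_def by auto
  have *: "\<exists>h :: 'a \<Rightarrow> 'a. inj h \<and> (\<forall>a. v (h a) (range h - {h a}) \<le> \<epsilon>)"
    if "\<And>a. bounded_superadditive M (v a)" "\<And>a. v a UNIV \<le> real n * \<epsilon>"
    for n :: nat and v :: "'a \<Rightarrow> 'a set \<Rightarrow> real"
    using that
  proof (induction n arbitrary: v)
    case (0 v)
    have "v a (UNIV - {a}) \<le> \<epsilon>" for a
      using bounded_superadditive_mono[OF 0(1), of "UNIV - {a}" UNIV a] 0(2)[of a] \<open>0 < \<epsilon>\<close> by simp
    then show ?case
      by - (rule exI[of _ id], simp)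
  next
    case (Suc n v)
    define row where "row a b = p (a, b)" for a b
    have row: "inj (row a)" for a
      by (rule injI) (auto simp: row_def dest: injD[OF p])
    show ?case
    proof (cases "\<exists>a. \<forall>c \<in> range (row a). v c (range (row a) - {c}) \<le> \<epsilon>")
      case True
      then obtain a where "\<And>c. c \<in> range (row a) \<Longrightarrow> v c (range (row a) - {c}) \<le> \<epsilon>"
        by blast
      then show ?thesis
        using row by - (rule exI[of _ "row a"], simp)
    next
      case False
      then have "\<forall>a. \<exists>c. c \<in> range (row a) \<and> \<epsilon> < v c (range (row a) - {c})"
        by (auto simp: not_le)
      then obtain g where g: "\<And>a. g a \<in> range (row a)" "\<And>a. \<epsilon> < v (g a) (range (row a) - {g a})"
        by metis
      have disj: "range (row a) \<inter> range (row b) = {}" if "a \<noteq> b" for a b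
        using that by (auto simp: row_def dest: injD[OF p])
      then have "inj g"
        using g(1) by (intro injI) (metis IntI empty_iff)
      \<comment> \<open>Transporting the chosen set functions along \<open>g\<close> puts the induction hypothesis on the full index type.\<close>
      define w where "w a A = v (g a) (g ` A)" for a A
      have w: "bounded_superadditive M (w a)" for a
        unfolding bounded_superadditive_def
      proof (intro conjI allI impI)
        fix A B :: "'a set" assume "A \<inter> B = {}"
        then have "g ` A \<inter> g ` B = {}"
          using image_Int[OF \<open>inj g\<close>, of A B] by simp
        then show "w a A + w a B \<le> w a (A \<union> B)"
          using Suc.prems(1)[of "g a"] by (simp add: w_def bounded_superadditive_def image_Un)
      qed (use Suc.prems(1)[of "g a"] in \<open>auto simp: w_def bounded_superadditive_def\<close>)
      have "w a UNIV \<le> real n * \<epsilon>" for a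
      proof -
        have "range g \<inter> (range (row a) - {g a}) = {}"
        proof -
          have "g b \<notin> range (row a) - {g a}" for b
            using disj[of b a] g(1)[of b] by (cases "b = a") auto
          then show ?thesis by auto
        qed
        then have "v (g a) (range g) + v (g a) (range (row a) - {g a})
            \<le> v (g a) (range g \<union> (range (row a) - {g a}))"
          using Suc.prems(1)[of "g a"] unfolding bounded_superadditive_def by blast
        also have "\<dots> \<le> v (g a) UNIV"
          by (rule bounded_superadditive_mono[OF Suc.prems(1)]) simp
        finally show ?thesis
          using g(2)[of a] Suc.prems(2)[of "g a"] by (simp add: w_def algebra_simps)
      qed
      with Suc.IH[of w] w have "\<exists>h :: 'a \<Rightarrow> 'a. inj h \<and> (\<forall>a. w (h a) (range h - {h a}) \<le> \<epsilon>)"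
        by simp
      then obtain h :: "'a \<Rightarrow> 'a" where
        h: "inj h" "\<And>a. w (h a) (range h - {h a}) \<le> \<epsilon>"
        by auto
      have "g ` (range h - {h a}) = range (g \<circ> h) - {(g \<circ> h) a}" for a
        using \<open>inj g\<close> by (auto dest: injD)
      then have "v ((g \<circ> h) a) (range (g \<circ> h) - {(g \<circ> h) a}) \<le> \<epsilon>" for a
        using h(2)[of a] by (simp add: w_def)
      moreover have "inj (g \<circ> h)"
        using \<open>inj g\<close> h(1) by (rule inj_compose)
      ultimately show ?thesis
        by - (rule exI[of _ "g \<circ> h"], intro conjI allI)
    qed
  qed
  obtain n :: nat where n: "M / \<epsilon> < n"
    using reals_Archimedean2 by blast
  have "v a UNIV \<le> real n * \<epsilon>" for a
  proof -
    have "v a UNIV \<le> M"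
      using v[of a] by (simp add: bounded_superadditive_def)
    also have "M \<le> real n * \<epsilon>"
      using n \<open>0 < \<epsilon>\<close> by (simp add: field_simps)
    finally show ?thesis .
  qed
  then have "\<exists>h :: 'a \<Rightarrow> 'a. inj h \<and> (\<forall>a. v (h a) (range h - {h a}) \<le> \<epsilon>)"
    using *[of v n] v by simp
  then show thesis
    using that by auto
qed


lemma infinite_Un_injection:
  assumes inf: "infinite (UNIV :: 'a set)" and Un: "G \<union> H = (UNIV :: 'a set)"
  obtains h :: "'a \<Rightarrow> 'a" where "inj h" "range h \<subseteq> G \<or> range h \<subseteq> H"
proof -
  have "\<not> (ordLess2 (card_of G) (card_of (UNIV :: 'a set)) \<and> ordLess2 (card_of H) (card_of (UNIV :: 'a set)))"
    using card_of_Un_ordLess_infinite[OF inf, of G H] Un ordLess_irreflexive by auto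
  then have "ordLeq3 (card_of (UNIV :: 'a set)) (card_of G) \<or> ordLeq3 (card_of (UNIV :: 'a set)) (card_of H)"
    using not_ordLess_iff_ordLeq[OF card_of_Well_order card_of_Well_order] by blast
  then show thesis
    unfolding card_of_ordLeq[symmetric] using that by blast
qed

section \<open>Elements through which the identity factors\<close>

text \<open>
  The elements through which the identity does not factor form a set stable under
  multiplication on both sides, and it contains every proper ideal, because an ideal containing
  an element outside it contains \<open>\<one>\<close>. So once the set is stable under addition it is the
  greatest proper ideal.
\<close>

lemma unique_maximal_ideal_of_nonfactors:
  fixes R :: "'a ring" (structure)
  defines "J \<equiv> {x \<in> carrier R. \<forall>a\<in>carrier R. \<forall>b\<in>carrier R. \<one> \<noteq> a \<otimes> x \<otimes> b}"
  assumes "ring R" and nontrivial: "\<one> \<noteq> \<zero>" and add: "\<And>x y. x \<in> J \<Longrightarrow> y \<in> J \<Longrightarrow> x \<oplus> y \<in> J"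
  shows "unique_maximal_ideal J R"
proof -
  interpret ring R by fact
  have l: "x \<otimes> a \<in> J" and r: "a \<otimes> x \<in> J" if "a \<in> J" "x \<in> carrier R" for a x
  proof -
    have "c \<otimes> (x \<otimes> a) \<otimes> d = (c \<otimes> x) \<otimes> a \<otimes> d" "c \<otimes> (a \<otimes> x) \<otimes> d = c \<otimes> a \<otimes> (x \<otimes> d)"
      if "c \<in> carrier R" "d \<in> carrier R" for c d
      using \<open>a \<in> J\<close> \<open>x \<in> carrier R\<close> that by (simp_all add: J_def m_assoc)
    then show "x \<otimes> a \<in> J" "a \<otimes> x \<in> J"
      using that by (auto simp: J_def)
  qed
  have "ideal J R"
  proof (rule idealI)
    show "subgroup J (add_monoid R)"
    proof
      show "\<one>\<^bsub>add_monoid R\<^esub> \<in> J"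
        using nontrivial by (simp add: J_def)
    next
      fix x assume x: "x \<in> J"
      have "inv\<^bsub>add_monoid R\<^esub> x = (\<ominus> \<one>) \<otimes> x"
        using x unfolding a_inv_def[symmetric] by (simp add: J_def l_minus)
      then show "inv\<^bsub>add_monoid R\<^esub> x \<in> J"
        using l[OF x] by simp
    qed (use add in \<open>auto simp: J_def\<close>)
  qed (use l r ring_axioms in auto)
  have factor_free: "I \<subseteq> J" if "ideal I R" "I \<noteq> carrier R" for I
  proof
    fix x assume "x \<in> I"
    interpret I: ideal I R by fact
    have "a \<otimes> x \<otimes> b \<in> I" if "a \<in> carrier R" "b \<in> carrier R" for a b
      using that \<open>x \<in> I\<close> by (simp add: I.I_l_closed I.I_r_closed)
    moreover have "\<one> \<notin> I"
      using I.one_imp_carrier that(2) by blast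
    ultimately show "x \<in> J"
      using \<open>x \<in> I\<close> I.Icarr by (auto simp: J_def)
  qed
  have proper: "carrier R \<noteq> J"
  proof -
    have "\<one> \<notin> J"
      using one_closed r_one by (auto simp: J_def intro!: bexI[of _ \<one>])
    then show ?thesis using one_closed by auto
  qed
  have "maximalideal J R"
    using \<open>ideal J R\<close> proper factor_free by (intro maximalidealI) auto
  moreover have "J' = J" if "maximalideal J' R" for J'
  proof -
    interpret J': maximalideal J' R by fact
    have "J' \<subseteq> J" "J \<subseteq> carrier R"
      using factor_free[OF J'.is_ideal] J'.I_notcarr by (auto simp: J_def)
    then show ?thesis
      using J'.I_maximal[OF \<open>ideal J R\<close>] proper by auto
  qed
  ultimately show ?thesis
    unfolding unique_maximal_ideal_def by blast
qed

section \<open>Bounded functions on a discrete set\<close>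

definition supp :: "('i, 'k::real_normed_field) linf \<Rightarrow> 'i discrete set" where
  "supp z = {\<alpha>. apply_bcontfun z \<alpha> \<noteq> 0}"

lemma linf_scale_apply [simp]: "apply_bcontfun (c *\<^sub>K z) \<alpha> = c * apply_bcontfun z \<alpha>"
  by transfer simp

lemma norm_linf_scale: "norm (c *\<^sub>K z) = norm c * norm z"
proof (cases "c = 0")
  case True
  then show ?thesis by simp
next
  case False
  \<comment> \<open>This inequality for the inverse scalar gives the reverse one.\<close>
  have le: "norm (d *\<^sub>K w) \<le> norm d * norm w" for d w
    by (rule norm_bound) (simp add: norm_mult mult_left_mono norm_bounded)
  have "norm z = norm (inverse c *\<^sub>K c *\<^sub>K z)"
    using False by simp
  also have "\<dots> \<le> norm (inverse c) * norm (c *\<^sub>K z)"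
    by (rule le)
  finally have "norm c * norm z \<le> norm (c *\<^sub>K z)"
    using False by (simp add: norm_inverse norm_divide field_simps)
  with le[of c z] show ?thesis
    using False by (simp add: norm_divide field_simps)
qed

lemma apply_Bcontfun:
  fixes f :: "'i discrete \<Rightarrow> 'k::real_normed_field"
  assumes "\<And>\<alpha>. norm (f \<alpha>) \<le> M"
  shows "apply_bcontfun (Bcontfun f) = f"
proof -
  have "continuous_on UNIV f"
    by (simp add: continuous_on_open_vimage open_discrete)
  then show ?thesis
    using assms by (intro Bcontfun_inverse bcontfun_normI)
qed

definition unit_vector :: "'i discrete \<Rightarrow> ('i, 'k::real_normed_field) linf" where
  "unit_vector \<alpha> = Bcontfun (\<lambda>\<beta>. if \<beta> = \<alpha> then 1 else 0)"

lemma unit_vector_apply [simp]: "apply_bcontfun (unit_vector \<alpha>) \<beta> = (if \<beta> = \<alpha> then 1 else 0)"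
  unfolding unit_vector_def by (subst apply_Bcontfun[where M = 1]) auto

lemma supp_unit_vector [simp]: "supp (unit_vector \<alpha>) = {\<alpha>}"
  by (auto simp: supp_def)

lemma norm_unit_vector [simp]: "norm (unit_vector \<alpha> :: ('i, 'k::real_normed_field) linf) = 1"
proof (rule antisym)
  show "norm (unit_vector \<alpha> :: ('i, 'k) linf) \<le> 1"
    by (rule norm_bound) simp
  show "1 \<le> norm (unit_vector \<alpha> :: ('i, 'k) linf)"
    using norm_bounded[of "unit_vector \<alpha> :: ('i, 'k) linf" \<alpha>] by simp
qed

section \<open>The two spaces treated uniformly\<close>

text \<open>
  The condition \<open>solid\<close> treats both spaces at once. It holds for \<open>ell_inf\<close>, where membership
  is no restriction, and for \<open>ell_inf_c\<close>, where countable support is exactly membership. It says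
  that a function lies in the space as soon as it is obtained from a member by any coordinatewise
  construction that preserves countability of supports.
\<close>

locale coordinate_space =
  fixes X :: "('i, 'k::{real_normed_field, banach}) linf set"
  assumes infinite_index: "infinite (UNIV :: 'i discrete set)"
    and subspace: "linf.subspace X"
    and closed: "closed X"
    and solid: "\<And>z w. z \<in> X \<Longrightarrow> (countable (supp z) \<Longrightarrow> countable (supp w)) \<Longrightarrow> w \<in> X"

lemma
  assumes "infinite (UNIV :: 'i set)"
  shows coordinate_space_ell_inf: "coordinate_space (ell_inf :: ('i, 'k::{real_normed_field, banach}) linf set)"
    and coordinate_space_ell_inf_c: "coordinate_space (ell_inf_c :: ('i, 'k::{real_normed_field, banach}) linf set)"
proof -
  have "inj (discrete :: 'i \<Rightarrow> 'i discrete)"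
    by (auto simp: inj_def discrete_inject)
  then have inf: "infinite (UNIV :: 'i discrete set)"
    using assms by (meson finite_imageD finite_subset subset_UNIV)
  then show "coordinate_space (ell_inf :: ('i, 'k) linf set)"
    by unfold_locales (auto simp: ell_inf_def)
  have c: "ell_inf_c = {z :: ('i, 'k) linf. countable (supp z)}"
    by (simp add: ell_inf_c_def supp_def)
  show "coordinate_space (ell_inf_c :: ('i, 'k) linf set)"
  proof
    show "linf.subspace (ell_inf_c :: ('i, 'k) linf set)"
    proof (rule linf.subspaceI)
      fix z w :: "('i, 'k) linf" and a :: 'k
      assume z: "z \<in> ell_inf_c"
      have "supp (a *\<^sub>K z) \<subseteq> supp z"
        by (auto simp: supp_def)
      then show "a *\<^sub>K z \<in> ell_inf_c"
        using z by (auto simp: c intro: countable_subset)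
      assume w: "w \<in> ell_inf_c"
      have "supp (z + w) \<subseteq> supp z \<union> supp w"
        by (auto simp: supp_def)
      then show "z + w \<in> ell_inf_c"
        using z w by (auto simp: c intro: countable_subset)
    qed (simp add: c supp_def)
    show "closed (ell_inf_c :: ('i, 'k) linf set)"
      unfolding closed_sequential_limits
    proof safe
      fix f and l :: "('i, 'k) linf"
      assume f: "\<forall>n. f n \<in> ell_inf_c" and "f \<longlonglongrightarrow> l"
      have "supp l \<subseteq> (\<Union>n. supp (f n))"
      proof (rule subsetI, rule ccontr)
        fix \<alpha> assume l: "\<alpha> \<in> supp l" and "\<alpha> \<notin> (\<Union>n. supp (f n))"
        then have "apply_bcontfun (f n) \<alpha> = 0" for n
          by (auto simp: supp_def)
        moreover have "(\<lambda>n. apply_bcontfun (f n) \<alpha>) \<longlonglongrightarrow> apply_bcontfun l \<alpha>"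
          using tendsto_bcontfun_uniform_limit[OF \<open>f \<longlonglongrightarrow> l\<close>] by (rule tendsto_uniform_limitI) simp
        ultimately show False
          using l by (simp add: LIMSEQ_const_iff supp_def)
      qed
      moreover have "countable (\<Union>n. supp (f n))"
        using f by (auto simp: c)
      ultimately show "l \<in> ell_inf_c"
        unfolding c by (auto intro: countable_subset)
    qed
  qed (use inf in \<open>auto simp: c\<close>)
qed

context coordinate_space
begin

lemma zero_mem: "0 \<in> X"
  and add_mem: "x \<in> X \<Longrightarrow> y \<in> X \<Longrightarrow> x + y \<in> X"
  and scale_mem: "x \<in> X \<Longrightarrow> c *\<^sub>K x \<in> X"
  and diff_mem: "x \<in> X \<Longrightarrow> y \<in> X \<Longrightarrow> x - y \<in> X"
  using subspace
  by (auto intro: linf.subspace_0 linf.subspace_add linf.subspace_scale linf.subspace_diff)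

lemma unit_vector_mem: "unit_vector \<alpha> \<in> X"
  by (rule solid[OF zero_mem]) simp

section \<open>The ring of bounded operators\<close>

lemma bounded_operatorsI:
  assumes "\<And>x. x \<in> X \<Longrightarrow> f x \<in> X"
    and "\<And>x y. x \<in> X \<Longrightarrow> y \<in> X \<Longrightarrow> f (x + y) = f x + f y"
    and "\<And>c x. x \<in> X \<Longrightarrow> f (c *\<^sub>K x) = c *\<^sub>K f x"
    and "\<And>x. x \<in> X \<Longrightarrow> norm (f x) \<le> C * norm x"
  shows "restrict f X \<in> bounded_operators X"
  using assms add_mem scale_mem
  by (auto simp: bounded_operators_def linear_on_def intro!: exI[of _ C])

context
  fixes T assumes T: "T \<in> bounded_operators X"
begin

lemma operator_mem: "x \<in> X \<Longrightarrow> T x \<in> X"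
  and operator_add: "x \<in> X \<Longrightarrow> y \<in> X \<Longrightarrow> T (x + y) = T x + T y"
  and operator_scale: "x \<in> X \<Longrightarrow> T (c *\<^sub>K x) = c *\<^sub>K T x"
  and operator_restrict: "restrict T X = T"
  using T by (auto simp: bounded_operators_def linear_on_def extensional_restrict PiE_def)

lemma operator_zero: "T 0 = 0"
  using operator_scale[OF zero_mem, of 0] by simp

lemma operator_diff: "x \<in> X \<Longrightarrow> y \<in> X \<Longrightarrow> T (x - y) = T x - T y"
  using operator_add[of "x - y" y] diff_mem by (simp add: algebra_simps)

lemma operator_bound: obtains C where "0 < C" "\<And>x. x \<in> X \<Longrightarrow> norm (T x) \<le> C * norm x"
proof -
  obtain C where C: "\<And>x. x \<in> X \<Longrightarrow> norm (T x) \<le> C * norm x"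
    using T by (auto simp: bounded_operators_def)
  have "norm (T x) \<le> (\<bar>C\<bar> + 1) * norm x" if "x \<in> X" for x
  proof -
    have "C * norm x \<le> (\<bar>C\<bar> + 1) * norm x"
      by (intro mult_right_mono) auto
    with C[OF that] show ?thesis by linarith
  qed
  then show thesis using that[of "\<bar>C\<bar> + 1"] by simp
qed

lemma operator_continuous: "continuous_on X T"
proof -
  obtain C where C: "0 < C" "\<And>x. x \<in> X \<Longrightarrow> norm (T x) \<le> C * norm x"
    using operator_bound by blast
  have "C-lipschitz_on X T"
    using C by (intro lipschitz_onI) (auto simp: dist_norm operator_diff[symmetric] diff_mem)
  then show ?thesis by (rule lipschitz_on_continuous_on)
qed

end

lemma operator_eqI:
  assumes "S \<in> bounded_operators X" "T \<in> bounded_operators X" "\<And>x. x \<in> X \<Longrightarrow> S x = T x"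
  shows "S = T"
  using assms by (metis operator_restrict restrict_ext)

lemma compose_mem:
  assumes S: "S \<in> bounded_operators X" and T: "T \<in> bounded_operators X"
  shows "compose X S T \<in> bounded_operators X"
proof -
  obtain C where C: "0 < C" "\<And>x. x \<in> X \<Longrightarrow> norm (S x) \<le> C * norm x"
    using operator_bound[OF S] by blast
  obtain D where D: "0 < D" "\<And>x. x \<in> X \<Longrightarrow> norm (T x) \<le> D * norm x"
    using operator_bound[OF T] by blast
  have "norm (S (T x)) \<le> C * D * norm x" if "x \<in> X" for x
    using order_trans[OF C(2)[OF operator_mem[OF T that]] mult_left_mono[OF D(2)[OF that], of C]] C(1)
    by (simp add: mult.assoc)
  then show ?thesis
    unfolding compose_def using S T
    by (intro bounded_operatorsI[where C = "C * D"]) (simp_all add: operator_mem operator_add operator_scale)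
qed

lemma operator_algebra_simps [simp]:
  "carrier (operator_algebra X) = bounded_operators X"
  "S \<otimes>\<^bsub>operator_algebra X\<^esub> T = compose X S T"
  "S \<oplus>\<^bsub>operator_algebra X\<^esub> T = (\<lambda>x\<in>X. S x + T x)"
  "\<one>\<^bsub>operator_algebra X\<^esub> = (\<lambda>x\<in>X. x)"
  "\<zero>\<^bsub>operator_algebra X\<^esub> = (\<lambda>x\<in>X. 0)"
  by (simp_all add: operator_algebra_def)

lemma sum_mem:
  assumes S: "S \<in> bounded_operators X" and T: "T \<in> bounded_operators X"
  shows "(\<lambda>x\<in>X. S x + T x) \<in> bounded_operators X"
proof -
  obtain C where C: "\<And>x. x \<in> X \<Longrightarrow> norm (S x) \<le> C * norm x"
    using operator_bound[OF S] by blast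
  obtain D where D: "\<And>x. x \<in> X \<Longrightarrow> norm (T x) \<le> D * norm x"
    using operator_bound[OF T] by blast
  have "norm (S x + T x) \<le> (C + D) * norm x" if "x \<in> X" for x
    using norm_triangle_ineq[of "S x" "T x"] C[OF that] D[OF that] by (simp add: distrib_right)
  then show ?thesis
    using S T by (intro bounded_operatorsI[where C = "C + D"])
      (simp_all add: operator_mem operator_add operator_scale add_mem linf.scale_right_distrib)
qed

lemma scaled_operator_mem:
  assumes T: "T \<in> bounded_operators X"
  shows "(\<lambda>x\<in>X. c *\<^sub>K T x) \<in> bounded_operators X"
proof -
  obtain C where C: "\<And>x. x \<in> X \<Longrightarrow> norm (T x) \<le> C * norm x"
    using operator_bound[OF T] by blast
  have "norm (c *\<^sub>K T x) \<le> norm c * C * norm x" if "x \<in> X" for x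
    using mult_left_mono[OF C[OF that], of "norm c"] by (simp add: norm_linf_scale mult.assoc)
  then show ?thesis
    using T by (intro bounded_operatorsI[where C = "norm c * C"])
      (simp_all add: operator_mem operator_add operator_scale scale_mem
        linf.scale_right_distrib mult.commute)
qed

lemma identity_mem: "(\<lambda>x\<in>X. x) \<in> bounded_operators X"
  by (rule bounded_operatorsI[where C = 1]) simp_all

lemma zero_operator_mem: "(\<lambda>x\<in>X. 0) \<in> bounded_operators X"
  by (rule bounded_operatorsI[where C = 0]) (simp_all add: zero_mem)

lemma ring_operator_algebra: "ring (operator_algebra X)"
proof (rule ringI)
  show "abelian_group (operator_algebra X)"
  proof (rule abelian_groupI; unfold operator_algebra_simps)
    fix S assume S: "S \<in> bounded_operators X"
    show "\<exists>T\<in>bounded_operators X. (\<lambda>x\<in>X. T x + S x) = (\<lambda>x\<in>X. 0)"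
      by (rule bexI[OF _ scaled_operator_mem[OF S, of "- 1"]]) (auto simp: restrict_def)
    show "(\<lambda>x\<in>X. (\<lambda>x\<in>X. 0) x + S x) = S"
      using S by (intro operator_eqI sum_mem zero_operator_mem) simp_all
  qed (auto simp: sum_mem[unfolded restrict_def] zero_operator_mem[unfolded restrict_def] add_ac restrict_def add_mem zero_mem operator_mem)
  show "monoid (operator_algebra X)"
  proof (rule monoidI; unfold operator_algebra_simps)
    fix S assume S: "S \<in> bounded_operators X"
    show "compose X (\<lambda>x\<in>X. x) S = S" "compose X S (\<lambda>x\<in>X. x) = S"
      using S by (auto intro!: operator_eqI[OF compose_mem] identity_mem simp: compose_eq operator_mem)
  next
    fix S T U
    assume "S \<in> bounded_operators X" "T \<in> bounded_operators X" and U: "U \<in> bounded_operators X"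
    show "compose X (compose X S T) U = compose X S (compose X T U)"
      using U by (auto simp: compose_def restrict_def operator_mem[OF U])
  qed (simp_all add: compose_mem identity_mem)
next
  fix S T U
  assume S: "S \<in> carrier (operator_algebra X)" and T: "T \<in> carrier (operator_algebra X)"
    and U: "U \<in> carrier (operator_algebra X)"
  note mem = S[simplified] T[simplified] U[simplified]
  show "(S \<oplus>\<^bsub>operator_algebra X\<^esub> T) \<otimes>\<^bsub>operator_algebra X\<^esub> U
      = S \<otimes>\<^bsub>operator_algebra X\<^esub> U \<oplus>\<^bsub>operator_algebra X\<^esub> T \<otimes>\<^bsub>operator_algebra X\<^esub> U"
    by (rule ext) (simp add: compose_def restrict_def operator_mem[OF mem(3)])
  show "U \<otimes>\<^bsub>operator_algebra X\<^esub> (S \<oplus>\<^bsub>operator_algebra X\<^esub> T)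
      = U \<otimes>\<^bsub>operator_algebra X\<^esub> S \<oplus>\<^bsub>operator_algebra X\<^esub> U \<otimes>\<^bsub>operator_algebra X\<^esub> T"
    by (rule ext) (simp add: compose_def restrict_def operator_mem[OF mem(1)]
        operator_mem[OF mem(2)] operator_add[OF mem(3)])
qed

end

section \<open>Operators that move coordinates\<close>

text \<open>
  The two factors on either side of an operator are built from maps that move and rescale
  coordinates in this way.
\<close>

definition weighted_pullback ::
    "('i discrete \<Rightarrow> 'k::real_normed_field) \<Rightarrow> ('i discrete \<Rightarrow> 'i discrete) \<Rightarrow> ('i, 'k) linf \<Rightarrow> ('i, 'k) linf" where
  "weighted_pullback c k y = Bcontfun (\<lambda>\<alpha>. c \<alpha> * apply_bcontfun y (k \<alpha>))"

lemma weighted_pullback_apply: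
  assumes "\<And>\<alpha>. norm (c \<alpha>) \<le> M"
  shows "apply_bcontfun (weighted_pullback c k y) \<alpha> = c \<alpha> * apply_bcontfun y (k \<alpha>)"
    and "norm (c \<alpha> * apply_bcontfun y (k \<alpha>)) \<le> M * norm y"
proof -
  have *: "norm (c \<alpha> * apply_bcontfun y (k \<alpha>)) \<le> M * norm y" for \<alpha>
    unfolding norm_mult using assms norm_bounded[of y]
    by (intro mult_mono) (auto intro: order_trans[OF norm_ge_zero])
  then show "apply_bcontfun (weighted_pullback c k y) \<alpha> = c \<alpha> * apply_bcontfun y (k \<alpha>)"
    unfolding weighted_pullback_def by (subst apply_Bcontfun) auto
  from * show "norm (c \<alpha> * apply_bcontfun y (k \<alpha>)) \<le> M * norm y" .
qed

context coordinate_space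
begin

text \<open>
  The condition on the fibres keeps countable supports countable: without it a single nonzero
  coordinate of the argument could be copied to uncountably many places, which would leave
  \<open>ell_inf_c\<close>.
\<close>

lemma weighted_pullback_mem:
  assumes c: "\<And>\<alpha>. norm (c \<alpha>) \<le> M" and fibres: "\<And>i. countable {\<alpha>. c \<alpha> \<noteq> 0 \<and> k \<alpha> = i}"
  shows "restrict (weighted_pullback c k) X \<in> bounded_operators X"
proof (rule bounded_operatorsI[where C = M])
  note value_eq = weighted_pullback_apply[OF c]
  show "weighted_pullback c k y \<in> X" if "y \<in> X" for y
  proof (rule solid[OF that])
    assume "countable (supp y)"
    moreover have "supp (weighted_pullback c k y) \<subseteq> (\<Union>i\<in>supp y. {\<alpha>. c \<alpha> \<noteq> 0 \<and> k \<alpha> = i})"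
      by (auto simp: supp_def value_eq)
    ultimately show "countable (supp (weighted_pullback c k y))"
      using fibres by (auto intro: countable_subset)
  qed
  show "norm (weighted_pullback c k y) \<le> M * norm y" for y
    by (rule norm_bound, unfold value_eq(1), rule value_eq(2))
qed (auto intro!: bcontfun_eqI simp: weighted_pullback_apply[OF c] algebra_simps)



text \<open>
  An isometric embedding of the space, whose image consists of the members supported in \<open>range h\<close>.
\<close>

definition spread :: "('i discrete \<Rightarrow> 'i discrete) \<Rightarrow> ('i, 'k) linf \<Rightarrow> ('i, 'k) linf" where
  "spread h = (\<lambda>x\<in>X. weighted_pullback (\<lambda>\<beta>. if \<beta> \<in> range h then 1 else 0) (inv_into UNIV h) x)"

lemma spread_apply:
  assumes "inj h" "x \<in> X"
  shows "apply_bcontfun (spread h x) (h \<alpha>) = apply_bcontfun x \<alpha>"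
    and "\<beta> \<notin> range h \<Longrightarrow> apply_bcontfun (spread h x) \<beta> = 0"
  using assms by (simp_all add: spread_def weighted_pullback_apply[where M = 1])

lemma spread_mem:
  assumes "inj h"
  shows "spread h \<in> bounded_operators X"
proof -
  have "countable {\<beta>. (if \<beta> \<in> range h then 1 else 0) \<noteq> (0 :: 'k) \<and> inv_into UNIV h \<beta> = i}" for i
    by (rule countable_subset[of _ "{h i}"]) (auto simp: f_inv_into_f)
  then show ?thesis
    unfolding spread_def by (intro weighted_pullback_mem[where M = 1]) auto
qed

lemma norm_spread_le:
  assumes "x \<in> X"
  shows "norm (spread h x) \<le> norm x"
  using assms by (intro norm_bound)
    (simp add: spread_def weighted_pullback_apply[where M = 1] norm_bounded)

lemma spread_unit_vector:
  assumes "inj h"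
  shows "spread h (unit_vector \<alpha>) = unit_vector (h \<alpha>)"
proof (rule bcontfun_eqI)
  fix \<beta>
  show "apply_bcontfun (spread h (unit_vector \<alpha>)) \<beta> = apply_bcontfun (unit_vector (h \<alpha>)) \<beta>"
    using spread_apply[OF assms unit_vector_mem] assms
    by (cases "\<beta> \<in> range h") (auto simp: inj_eq)
qed

section \<open>Variation of the coordinate functionals of an operator\<close>

text \<open>
  For the functional \<open>\<phi>\<close> sending \<open>z\<close> to the coordinate \<open>i\<close> of \<open>T z\<close>, this is the norm of the restriction
  of \<open>\<phi>\<close> to the members supported in \<open>A\<close>, that is, the total variation on \<open>A\<close> of the finitely
  additive measure representing \<open>\<phi>\<close>.
\<close>

definition variation :: "(('i, 'k) linf \<Rightarrow> ('i, 'k) linf) \<Rightarrow> 'i discrete \<Rightarrow> 'i discrete set \<Rightarrow> real" where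
  "variation T i A = (SUP z\<in>{z \<in> X. norm z \<le> 1 \<and> supp z \<subseteq> A}. norm (apply_bcontfun (T z) i))"

context
  fixes T C
  assumes T: "T \<in> bounded_operators X" and C: "\<forall>x\<in>X. norm (T x) \<le> C * norm x"
    and C_pos: "0 < C"
begin

lemma norm_apply_le_bound:
  assumes "z \<in> X" "norm z \<le> 1"
  shows "norm (apply_bcontfun (T z) i) \<le> C"
proof -
  have "norm (apply_bcontfun (T z) i) \<le> C * norm z"
    using norm_bounded[of "T z" i] bspec[OF C assms(1)] by linarith
  also have "\<dots> \<le> C * 1"
    using assms(2) C_pos by (intro mult_left_mono) auto
  finally show ?thesis by simp
qed

lemma variation_upper:
  assumes "z \<in> X" "norm z \<le> 1" "supp z \<subseteq> A"
  shows "norm (apply_bcontfun (T z) i) \<le> variation T i A"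
  unfolding variation_def
  by (rule cSUP_upper) (use assms norm_apply_le_bound in \<open>auto intro!: bdd_aboveI[of _ C]\<close>)

lemma variation_least:
  assumes "\<And>z. z \<in> X \<Longrightarrow> norm z \<le> 1 \<Longrightarrow> supp z \<subseteq> A \<Longrightarrow> norm (apply_bcontfun (T z) i) \<le> b"
  shows "variation T i A \<le> b"
  unfolding variation_def
proof (rule cSUP_least)
  have "0 \<in> {z \<in> X. norm z \<le> 1 \<and> supp z \<subseteq> A}"
    by (simp add: zero_mem supp_def)
  then show "{z \<in> X. norm z \<le> 1 \<and> supp z \<subseteq> A} \<noteq> {}" by blast
qed (use assms in auto)

lemma norm_apply_le_variation:
  assumes "z \<in> X" "supp z \<subseteq> A"
  shows "norm (apply_bcontfun (T z) i) \<le> variation T i A * norm z"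
proof (cases "z = 0")
  case True
  then show ?thesis by (simp add: operator_zero[OF T])
next
  case False
  define c :: 'k where "c = of_real (inverse (norm z))"
  have c: "norm c = inverse (norm z)" by (simp add: c_def del: of_real_inverse)
  have "norm (apply_bcontfun (T (c *\<^sub>K z)) i) \<le> variation T i A"
  proof (rule variation_upper)
    show "supp (c *\<^sub>K z) \<subseteq> A" using assms(2) by (auto simp: supp_def)
  qed (use False assms in \<open>auto simp: scale_mem norm_linf_scale c\<close>)
  then show ?thesis
    using False by (simp add: operator_scale[OF T assms(1)] norm_mult c field_simps)
qed

text \<open>
  Two members of the unit ball with disjoint supports can be multiplied by scalars of modulus one
  so that the values of the functional become nonnegative reals. Their sum is still in the unit
  ball, since the norm is a supremum, and the values add up.
\<close>

lemma bounded_superadditive_variation: "bounded_superadditive C (variation T i)"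
  unfolding bounded_superadditive_def
proof (intro conjI allI impI)
  fix A
  have "norm (apply_bcontfun (T 0) i) \<le> variation T i A"
    by (rule variation_upper) (auto simp: zero_mem supp_def)
  then show "0 \<le> variation T i A" using order_trans norm_ge_zero by blast
  show "variation T i A \<le> C"
    by (rule variation_least) (rule norm_apply_le_bound)
next
  fix A B :: "'i discrete set"
  assume disj: "A \<inter> B = {}"
  have rotate: "\<exists>u. norm u = 1 \<and> u * a = of_real (norm a)" for a :: 'k
    by (rule exI[of _ "if a = 0 then 1 else of_real (norm a) / a"]) (auto simp: norm_divide)
  have *: "norm (apply_bcontfun (T z) i) + norm (apply_bcontfun (T w) i) \<le> variation T i (A \<union> B)"
    if z: "z \<in> X" "norm z \<le> 1" "supp z \<subseteq> A" and w: "w \<in> X" "norm w \<le> 1" "supp w \<subseteq> B" for z w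
  proof -
    obtain u u' where u: "norm u = 1" "u * apply_bcontfun (T z) i = of_real (norm (apply_bcontfun (T z) i))"
      and u': "norm u' = 1" "u' * apply_bcontfun (T w) i = of_real (norm (apply_bcontfun (T w) i))"
      using rotate by metis
    define x where "x = u *\<^sub>K z + u' *\<^sub>K w"
    have "x \<in> X"
      using z w by (simp add: x_def add_mem scale_mem)
    moreover have "norm x \<le> 1"
    proof (rule norm_bound)
      fix \<alpha>
      have "\<alpha> \<notin> supp z \<or> \<alpha> \<notin> supp w" using z w disj by blast
      then show "norm (apply_bcontfun x \<alpha>) \<le> 1"
        using u u' z w norm_bounded[of z \<alpha>] norm_bounded[of w \<alpha>]
        by (auto simp: x_def supp_def norm_mult)
    qed
    moreover have "supp x \<subseteq> A \<union> B"
      using z w by (fastforce simp: x_def supp_def)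
    ultimately have "norm (apply_bcontfun (T x) i) \<le> variation T i (A \<union> B)"
      by (rule variation_upper)
    moreover have "apply_bcontfun (T x) i
        = of_real (norm (apply_bcontfun (T z) i) + norm (apply_bcontfun (T w) i))"
      using z w u u' by (simp add: x_def operator_add[OF T] operator_scale[OF T] scale_mem)
    ultimately show ?thesis
      by (simp add: norm_of_real del: of_real_add)
  qed
  have "norm (apply_bcontfun (T z) i) \<le> variation T i (A \<union> B) - variation T i B"
    if "z \<in> X" "norm z \<le> 1" "supp z \<subseteq> A" for z
    using variation_least[of B i "variation T i (A \<union> B) - norm (apply_bcontfun (T z) i)"] *[OF that]
    by (simp add: algebra_simps)
  then show "variation T i A + variation T i B \<le> variation T i (A \<union> B)"
    using variation_least[of A i "variation T i (A \<union> B) - variation T i B"] by simp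
qed

end

section \<open>Factoring the identity\<close>

text \<open>
  Perturbation of the identity. Surjectivity is Banach's fixed point theorem for the contraction
  \<open>x \<mapsto> y - (V x - x)\<close>, which is where closedness of the space is needed.
\<close>

lemma near_identity_left_invertible:
  assumes V: "V \<in> bounded_operators X" and "q < 1"
    and near: "\<And>x. x \<in> X \<Longrightarrow> norm (V x - x) \<le> q * norm x"
  obtains W where "W \<in> bounded_operators X" "compose X W V = (\<lambda>x\<in>X. x)"
proof -
  have "0 \<le> q"
    using order_trans[OF norm_ge_zero near[OF unit_vector_mem]] by simp
  have below: "norm x \<le> inverse (1 - q) * norm (V x)" if "x \<in> X" for x
  proof -
    have "norm x \<le> norm (V x) + norm (V x - x)"
      using norm_triangle_ineq4[of "V x" "V x - x"] by simp
    then show ?thesis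
      using near[OF that] \<open>q < 1\<close> by (simp add: field_simps)
  qed
  have inj: "inj_on V X"
  proof (rule inj_onI)
    fix x y assume "x \<in> X" "y \<in> X" "V x = V y"
    then show "x = y"
      using below[OF diff_mem, of x y] by (simp add: operator_diff[OF V])
  qed
  have surj: "y \<in> V ` X" if y: "y \<in> X" for y
  proof -
    have "\<exists>!x\<in>X. y - (V x - x) = x"
    proof (rule Banach_fix)
      show "complete X" using closed by (simp add: complete_eq_closed)
      show "X \<noteq> {}" using zero_mem by blast
      show "(\<lambda>x. y - (V x - x)) ` X \<subseteq> X"
        using y by (auto intro!: diff_mem operator_mem[OF V])
      fix x x' assume x: "x \<in> X" "x' \<in> X"
      have "dist (y - (V x - x)) (y - (V x' - x')) = norm (V (x - x') - (x - x'))"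
        using x by (simp add: dist_norm operator_diff[OF V] norm_minus_commute algebra_simps)
      also have "\<dots> \<le> q * dist x x'"
        using near[OF diff_mem[OF x]] by (simp add: dist_norm)
      finally show "dist (y - (V x - x)) (y - (V x' - x')) \<le> q * dist x x'" .
    qed fact+
    then obtain x where "x \<in> X" "y - (V x - x) = x" by blast
    then have "y = V x" by (simp add: algebra_simps)
    with \<open>x \<in> X\<close> show ?thesis by blast
  qed
  define W where "W = inv_into X V"
  have W: "W y \<in> X" "V (W y) = y" if "y \<in> X" for y
    using surj[OF that] by (simp_all add: W_def inv_into_into f_inv_into_f)
  have WV: "W (V x) = x" if "x \<in> X" for x
    using that inj by (simp add: W_def)
  have "restrict W X \<in> bounded_operators X"
  proof (rule bounded_operatorsI)
    fix x y assume x: "x \<in> X" and y: "y \<in> X"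
    have "V (W x + W y) = x + y"
      using W x y by (simp add: operator_add[OF V])
    then show "W (x + y) = W x + W y"
      using WV[OF add_mem] W(1) x y by metis
  next
    fix c x assume x: "x \<in> X"
    have "V (c *\<^sub>K W x) = c *\<^sub>K x"
      using W x by (simp add: operator_scale[OF V])
    then show "W (c *\<^sub>K x) = c *\<^sub>K W x"
      using WV[OF scale_mem] W(1) x by metis
  next
    show "norm (W x) \<le> inverse (1 - q) * norm x" if "x \<in> X" for x
      using below[OF W(1)] W(2) that by simp
  qed (rule W)
  moreover have "compose X (restrict W X) V = (\<lambda>x\<in>X. x)"
    using WV by (auto simp: compose_def restrict_def operator_mem[OF V])
  ultimately show thesis by (rule that)
qed

definition identity_factors_through :: "(('i, 'k) linf \<Rightarrow> ('i, 'k) linf) \<Rightarrow> bool" where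
  "identity_factors_through T \<longleftrightarrow>
     (\<exists>A\<in>bounded_operators X. \<exists>B\<in>bounded_operators X. (\<lambda>x\<in>X. x) = compose X (compose X A T) B)"

lemma identity_factors_through_middle:
  assumes "P \<in> bounded_operators X" "S \<in> bounded_operators X" "Q \<in> bounded_operators X"
    and "identity_factors_through (compose X (compose X P S) Q)"
  shows "identity_factors_through S"
proof -
  obtain A B where AB: "A \<in> bounded_operators X" "B \<in> bounded_operators X"
    "(\<lambda>x\<in>X. x) = compose X (compose X A (compose X (compose X P S) Q)) B"
    using assms(4) by (auto simp: identity_factors_through_def)
  have "compose X (compose X A (compose X (compose X P S) Q)) B
      = compose X (compose X (compose X A P) S) (compose X Q B)"
    using assms(1-3) AB(1,2) by (auto simp: compose_def restrict_def operator_mem)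
  then show ?thesis
    unfolding identity_factors_through_def using AB assms(1-3) compose_mem by metis
qed

text \<open>
  For each \<open>\<alpha>\<close> choose a coordinate \<open>j \<alpha>\<close> at which the image of the unit vector at \<open>\<alpha>\<close> is larger
  than \<open>\<delta> / 2\<close>. Rosenthal's lemma yields \<open>\<lambda>\<close> many indices such that each functional \<open>(T z) (j \<alpha>)\<close>
  hardly sees the other unit vectors, even taken all at once. Restricting \<open>T\<close> to those indices and
  reading off the chosen coordinates, divided by the diagonal entries, therefore gives an
  operator at distance at most \<open>1 / 2\<close> from the identity, and this operator can be inverted.
\<close>

theorem identity_factors_through_large_on_unit_vectors:
  assumes T: "T \<in> bounded_operators X" and "0 < \<delta>"
    and large: "\<And>\<alpha>. \<delta> \<le> norm (T (unit_vector \<alpha>))"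
  shows "identity_factors_through T"
proof -
  obtain C where C_pos: "0 < C" and C: "\<And>x. x \<in> X \<Longrightarrow> norm (T x) \<le> C * norm x"
    using operator_bound[OF T] by blast
  have C_ball: "\<forall>x\<in>X. norm (T x) \<le> C * norm x"
    using C by blast
  note superadditive = bounded_superadditive_variation[OF T C_ball C_pos]
  note le_variation = norm_apply_le_variation[OF T C_ball C_pos]
  have "\<exists>i. \<delta> / 2 < norm (apply_bcontfun (T (unit_vector \<alpha>)) i)" for \<alpha>
  proof (rule ccontr)
    assume "\<nexists>i. \<delta> / 2 < norm (apply_bcontfun (T (unit_vector \<alpha>)) i)"
    then have "norm (T (unit_vector \<alpha>)) \<le> \<delta> / 2"
      by (intro norm_bound) (simp add: not_less)
    then show False using large[of \<alpha>] \<open>0 < \<delta>\<close> by simp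
  qed
  then obtain j where j: "\<And>\<alpha>. \<delta> / 2 < norm (apply_bcontfun (T (unit_vector \<alpha>)) (j \<alpha>))"
    by metis
  obtain h :: "'i discrete \<Rightarrow> 'i discrete"
    where h: "inj h" "\<And>\<alpha>. variation T (j (h \<alpha>)) (range h - {h \<alpha>}) \<le> \<delta> / 4"
    using rosenthal_lemma[OF infinite_index, of "\<delta> / 4" C "\<lambda>\<alpha>. variation T (j \<alpha>)"]
      superadditive \<open>0 < \<delta>\<close> by auto
  define d where "d \<alpha> = apply_bcontfun (T (unit_vector (h \<alpha>))) (j (h \<alpha>))" for \<alpha>
  have d: "\<delta> / 2 < norm (d \<alpha>)" for \<alpha>
    using j by (simp add: d_def)
  have d_inv: "norm (inverse (d \<alpha>)) \<le> 2 / \<delta>" for \<alpha>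
    using le_imp_inverse_le[of "\<delta> / 2" "norm (d \<alpha>)"] d[of \<alpha>] \<open>0 < \<delta>\<close>
    by (simp add: norm_inverse)
  define A where "A = restrict (weighted_pullback (\<lambda>\<alpha>. inverse (d \<alpha>)) (j \<circ> h)) X"
  have A: "A \<in> bounded_operators X"
    unfolding A_def
  \<comment> \<open>A coordinate is chosen only finitely often, since the functional there has bounded variation
    and each index choosing it contributes more than \<open>\<delta> / 2\<close>.\<close>
  proof (rule weighted_pullback_mem[OF d_inv])
    fix i
    have "j \<gamma> = i \<Longrightarrow> \<delta> / 2 \<le> variation T i {\<gamma>}" for \<gamma>
      using le_variation[OF unit_vector_mem, of \<gamma> "{\<gamma>}" "j \<gamma>"] j[of \<gamma>] by simp
    then have "{\<alpha>. inverse (d \<alpha>) \<noteq> 0 \<and> (j \<circ> h) \<alpha> = i} \<subseteq> h -` {\<gamma>. \<delta> / 2 \<le> variation T i {\<gamma>}}"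
      by auto
    moreover have "finite (h -` {\<gamma>. \<delta> / 2 \<le> variation T i {\<gamma>}})"
      using \<open>0 < \<delta>\<close>
      by (intro finite_vimageI[OF bounded_superadditive_finite_atoms[OF superadditive] h(1)]) simp
    ultimately show "countable {\<alpha>. inverse (d \<alpha>) \<noteq> 0 \<and> (j \<circ> h) \<alpha> = i}"
      by (meson countable_finite countable_subset)
  qed
  define B where "B = spread h"
  have B: "B \<in> bounded_operators X"
    unfolding B_def by (rule spread_mem[OF h(1)])
  define V where "V = compose X (compose X A T) B"
  have V: "V \<in> bounded_operators X"
    unfolding V_def by (intro compose_mem A B T)
  have "norm (V x - x) \<le> 1 / 2 * norm x" if x: "x \<in> X" for x
  proof (rule norm_bound)
    fix \<alpha>
    \<comment> \<open>Off the diagonal entry, \<open>V x\<close> differs from \<open>x\<close> at \<open>\<alpha>\<close> only through this remainder.\<close>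
    define r where "r = B x - apply_bcontfun x \<alpha> *\<^sub>K unit_vector (h \<alpha>)"
    have r: "r \<in> X"
      unfolding r_def by (intro diff_mem scale_mem unit_vector_mem operator_mem[OF B x])
    have r_apply: "apply_bcontfun r \<beta> = (if \<beta> = h \<alpha> then 0 else apply_bcontfun (B x) \<beta>)" for \<beta>
      by (simp add: r_def B_def spread_apply[OF h(1) x])
    have "norm r \<le> norm x"
      using norm_spread_le[OF x, of h]
      by (intro norm_bound) (auto simp: r_apply B_def intro: order_trans[OF norm_bounded])
    have "supp r \<subseteq> range h - {h \<alpha>}"
      using spread_apply(2)[OF h(1) x] by (auto simp: supp_def r_apply B_def split: if_splits)
    then have "norm (apply_bcontfun (T r) (j (h \<alpha>))) \<le> variation T (j (h \<alpha>)) (range h - {h \<alpha>}) * norm r"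
      by (rule le_variation[OF r])
    also have "\<dots> \<le> \<delta> / 4 * norm x"
      using h(2) \<open>norm r \<le> norm x\<close> \<open>0 < \<delta>\<close> by (intro mult_mono) auto
    finally have Tr: "norm (apply_bcontfun (T r) (j (h \<alpha>))) \<le> \<delta> / 4 * norm x" .
    have "apply_bcontfun (T r) (j (h \<alpha>)) = apply_bcontfun (T (B x)) (j (h \<alpha>)) - apply_bcontfun x \<alpha> * d \<alpha>"
      by (simp add: r_def d_def operator_diff[OF T] operator_scale[OF T] operator_mem[OF B x]
          scale_mem unit_vector_mem)
    moreover have "apply_bcontfun (V x) \<alpha> = inverse (d \<alpha>) * apply_bcontfun (T (B x)) (j (h \<alpha>))"
      using x by (simp add: V_def A_def compose_eq operator_mem[OF B] operator_mem[OF T]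
          weighted_pullback_apply[OF d_inv])
    moreover have "d \<alpha> \<noteq> 0"
      using d[of \<alpha>] \<open>0 < \<delta>\<close> by auto
    ultimately have "apply_bcontfun (V x - x) \<alpha> = inverse (d \<alpha>) * apply_bcontfun (T r) (j (h \<alpha>))"
      by (simp add: field_simps)
    then have "norm (apply_bcontfun (V x - x) \<alpha>) = norm (inverse (d \<alpha>)) * norm (apply_bcontfun (T r) (j (h \<alpha>)))"
      by (simp add: norm_mult)
    also have "\<dots> \<le> 2 / \<delta> * (\<delta> / 4 * norm x)"
      using d_inv Tr \<open>0 < \<delta>\<close> by (intro mult_mono) auto
    finally show "norm (apply_bcontfun (V x - x) \<alpha>) \<le> 1 / 2 * norm x"
      using \<open>0 < \<delta>\<close> by simp
  qed
  then obtain W where W: "W \<in> bounded_operators X" "compose X W V = (\<lambda>x\<in>X. x)"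
    using near_identity_left_invertible[OF V, of "1 / 2"] by auto
  have "compose X W V = compose X (compose X (compose X W A) T) B"
    by (auto simp: V_def compose_def restrict_def operator_mem[OF B] operator_mem[OF T])
  then show ?thesis
    unfolding identity_factors_through_def using W A B compose_mem by metis
qed

text \<open>
  If \<open>A (S + T) B\<close> is the identity, then for each unit vector one of \<open>A S B\<close> and \<open>A T B\<close> maps it
  to a vector of norm at least \<open>1 / 2\<close>. One of the two operators does so for \<open>\<lambda>\<close> many unit
  vectors, and after spreading the space over the corresponding coordinates the preceding theorem
  applies to it.
\<close>

lemma identity_factors_through_summand:
  assumes S: "S \<in> bounded_operators X" and T: "T \<in> bounded_operators X"
    and "identity_factors_through (\<lambda>x\<in>X. S x + T x)"
  shows "identity_factors_through S \<or> identity_factors_through T"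
proof -
  obtain A B where A: "A \<in> bounded_operators X" and B: "B \<in> bounded_operators X"
    and AB: "(\<lambda>x\<in>X. x) = compose X (compose X A (\<lambda>x\<in>X. S x + T x)) B"
    using assms(3) by (auto simp: identity_factors_through_def)
  define large where "large R = {\<gamma>. 1 / 2 \<le> norm (compose X (compose X A R) B (unit_vector \<gamma>))}" for R
  have "\<gamma> \<in> large S \<union> large T" for \<gamma>
  proof -
    have "unit_vector \<gamma> = compose X (compose X A S) B (unit_vector \<gamma>)
        + compose X (compose X A T) B (unit_vector \<gamma>)"
      using fun_cong[OF AB, of "unit_vector \<gamma>"] unit_vector_mem
      by (simp add: compose_def operator_mem[OF B] operator_mem[OF S] operator_mem[OF T] operator_add[OF A])
    then have "1 \<le> norm (compose X (compose X A S) B (unit_vector \<gamma>))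
        + norm (compose X (compose X A T) B (unit_vector \<gamma>))"
      by (metis norm_triangle_ineq norm_unit_vector)
    then show ?thesis by (auto simp: large_def)
  qed
  then have Un: "large S \<union> large T = UNIV" by blast
  have factor: "identity_factors_through R"
    if R: "R \<in> bounded_operators X" and h: "inj h" "range h \<subseteq> large R"
    for R and h :: "'i discrete \<Rightarrow> 'i discrete"
  proof -
    let ?U = "compose X (compose X A R) (compose X B (spread h))"
    have "?U (unit_vector \<alpha>) = compose X (compose X A R) B (unit_vector (h \<alpha>))" for \<alpha>
      using unit_vector_mem by (simp add: compose_def spread_unit_vector[OF h(1)] operator_mem[OF B])
    then have "1 / 2 \<le> norm (?U (unit_vector \<alpha>))" for \<alpha>
      using h(2) by (auto simp: large_def)
    then have "identity_factors_through ?U"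
      by (intro identity_factors_through_large_on_unit_vectors[of _ "1 / 2"]
          compose_mem A R B spread_mem h(1)) auto
    then show ?thesis
      by (rule identity_factors_through_middle[rotated 3]) (intro compose_mem A R B spread_mem h(1))+
  qed
  obtain h :: "'i discrete \<Rightarrow> 'i discrete"
    where h: "inj h" "range h \<subseteq> large S \<or> range h \<subseteq> large T"
    by (rule infinite_Un_injection[OF infinite_index Un])
  then show ?thesis
    using factor[OF S h(1)] factor[OF T h(1)] by blast
qed

text \<open>
  For the forward direction the isomorphism \<open>U\<close> onto the copy makes \<open>T U\<close> bounded below, in particular on
  the unit vectors, so the identity factors through \<open>T U\<close>.
  Conversely, if \<open>A T B\<close> is the identity, then \<open>T\<close> is bounded below on the range of
  \<open>B\<close>, and \<open>A T\<close> is there the inverse of \<open>B\<close>.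
\<close>

lemma bounded_below_on_copy_iff:
  assumes T: "T \<in> bounded_operators X"
  shows "bounded_below_on_copy X T X \<longleftrightarrow> identity_factors_through T"
proof
  assume "bounded_below_on_copy X T X"
  then obtain E f g c where E: "E \<subseteq> X" and lin: "linear_on X f" and hom: "homeomorphism X E f g"
    and c: "0 < c" "\<And>y. y \<in> E \<Longrightarrow> c * norm y \<le> norm (T y)"
    by (auto simp: bounded_below_on_copy_def isomorphic_spaces_def bounded_below_on_def)
  have fE: "f x \<in> E" if "x \<in> X" for x
    using hom that by (auto simp: homeomorphism_def)
  have f_scale: "f (a *\<^sub>K x) = a *\<^sub>K f x" if "x \<in> X" for a x
    using lin that by (simp add: linear_on_def)
  have f0: "f 0 = 0" using f_scale[OF zero_mem, of 0] by simp
  have g: "g (f x) = x" if "x \<in> X" for x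
    using hom that by (simp add: homeomorphism_def)
  have "continuous_on X f" "continuous_on E g"
    using hom by (simp_all add: homeomorphism_def)
  from \<open>continuous_on X f\<close> obtain d where d: "0 < d" "\<And>x. x \<in> X \<Longrightarrow> norm x < d \<Longrightarrow> norm (f x) < 1"
    unfolding continuous_on_iff using zero_mem f0 by (metis dist_0_norm dist_commute zero_less_one)
  have "0 \<in> E" "g 0 = 0"
    using fE[OF zero_mem] g[OF zero_mem] f0 by simp_all
  with \<open>continuous_on E g\<close> obtain \<epsilon> where \<epsilon>: "0 < \<epsilon>" "\<And>y. y \<in> E \<Longrightarrow> norm y < \<epsilon> \<Longrightarrow> norm (g y) < 1"
    unfolding continuous_on_iff by (metis dist_0_norm dist_commute zero_less_one)
  define U where "U = restrict f X"
  have U: "U \<in> bounded_operators X"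
    unfolding U_def
  proof (rule bounded_operatorsI)
    fix x assume x: "x \<in> X"
    show "norm (f x) \<le> 2 / d * norm x"
    proof (cases "x = 0")
      case False
      define a :: 'k where "a = of_real (d / (2 * norm x))"
      have a: "norm a = d / (2 * norm x)"
        unfolding a_def norm_of_real using d(1) by simp
      have "norm (f (a *\<^sub>K x)) < 1"
        using x d(1) False by (intro d(2)) (simp_all add: scale_mem norm_linf_scale a)
      then show ?thesis
        using d(1) False by (simp add: f_scale[OF x] norm_linf_scale a field_simps)
    qed (simp add: f0)
  qed (use lin E fE in \<open>auto simp: linear_on_def\<close>)
  \<comment> \<open>Since \<open>g\<close> maps \<open>f (unit_vector \<alpha>)\<close> to a vector of norm 1, the choice of \<open>\<epsilon>\<close> forces
    \<open>f (unit_vector \<alpha>)\<close> to have norm at least \<open>\<epsilon>\<close>.\<close>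
  have "c * \<epsilon> \<le> norm (compose X T U (unit_vector \<alpha>))" for \<alpha>
  proof -
    have "\<epsilon> \<le> norm (f (unit_vector \<alpha>))"
      using \<epsilon>(2)[OF fE[OF unit_vector_mem], of \<alpha>] g[OF unit_vector_mem, of \<alpha>] by fastforce
    then have "c * \<epsilon> \<le> c * norm (f (unit_vector \<alpha>))"
      using c(1) by simp
    also have "\<dots> \<le> norm (T (f (unit_vector \<alpha>)))"
      by (rule c(2)[OF fE[OF unit_vector_mem]])
    finally show ?thesis
      using unit_vector_mem by (simp add: compose_eq U_def)
  qed
  then have "identity_factors_through (compose X T U)"
    using c(1) \<epsilon>(1)
    by (intro identity_factors_through_large_on_unit_vectors[of _ "c * \<epsilon>"] compose_mem T U) auto
  moreover have "compose X (compose X (\<lambda>x\<in>X. x) T) U = compose X T U"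
    using T U by (auto simp: compose_def restrict_def operator_mem)
  ultimately show "identity_factors_through T"
    using identity_factors_through_middle[OF identity_mem T U] by simp
next
  assume "identity_factors_through T"
  then obtain A B where A: "A \<in> bounded_operators X" and B: "B \<in> bounded_operators X"
    and AB: "(\<lambda>x\<in>X. x) = compose X (compose X A T) B"
    by (auto simp: identity_factors_through_def)
  have ATB: "A (T (B x)) = x" if "x \<in> X" for x
    using fun_cong[OF AB, of x] that by (simp add: compose_def operator_mem[OF B])
  have BX: "B ` X \<subseteq> X" using operator_mem[OF B] by blast
  obtain CA where CA: "0 < CA" "\<And>x. x \<in> X \<Longrightarrow> norm (A x) \<le> CA * norm x"
    using operator_bound[OF A] by blast
  obtain CB where CB: "0 < CB" "\<And>x. x \<in> X \<Longrightarrow> norm (B x) \<le> CB * norm x"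
    using operator_bound[OF B] by blast
  have "linf.subspace (B ` X)"
  proof (rule linf.subspaceI)
    show "0 \<in> B ` X" using operator_zero[OF B] zero_mem by force
  next
    fix x y assume "x \<in> B ` X" "y \<in> B ` X"
    then show "x + y \<in> B ` X" using operator_add[OF B] add_mem by (auto simp: image_iff) metis
  next
    fix a x assume "x \<in> B ` X"
    then show "a *\<^sub>K x \<in> B ` X" using operator_scale[OF B] scale_mem by (auto simp: image_iff) metis
  qed
  moreover have "isomorphic_spaces X (B ` X)"
    unfolding isomorphic_spaces_def
  proof (intro exI conjI)
    show "linear_on X B"
      using operator_add[OF B] operator_scale[OF B] by (simp add: linear_on_def)
    have "continuous_on (B ` X) (A \<circ> T)"
    proof (rule continuous_on_compose)
      show "continuous_on (B ` X) T"
        using operator_continuous[OF T] BX by (rule continuous_on_subset)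
      show "continuous_on (T ` B ` X) A"
        using operator_continuous[OF A] by (rule continuous_on_subset) (use BX operator_mem[OF T] in blast)
    qed
    then show "homeomorphism X (B ` X) B (A \<circ> T)"
      using operator_continuous[OF B] ATB by (auto simp: homeomorphism_def image_iff)
  qed
  moreover have "bounded_below_on (B ` X) T"
    unfolding bounded_below_on_def
  proof (intro exI conjI ballI)
    show "0 < inverse (CA * CB)" using CA CB by simp
    fix y assume "y \<in> B ` X"
    then obtain x where x: "x \<in> X" "y = B x" by blast
    have "norm y \<le> CB * norm x" using CB x by simp
    also have "norm x \<le> CA * norm (T y)"
      using CA(2)[OF operator_mem[OF T operator_mem[OF B x(1)]]] ATB[OF x(1)] x(2) by simp
    finally show "inverse (CA * CB) * norm y \<le> norm (T y)"
      using CA(1) CB(1) by (simp add: field_simps)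
  qed
  ultimately show "bounded_below_on_copy X T X"
    using BX by (auto simp: bounded_below_on_copy_def)
qed

section \<open>The unique maximal ideal\<close>

theorem singular_operators_unique_maximal_ideal:
  shows "singular_operators X =
      {T \<in> carrier (operator_algebra X).
        \<forall>A\<in>carrier (operator_algebra X). \<forall>B\<in>carrier (operator_algebra X).
          \<one>\<^bsub>operator_algebra X\<^esub> \<noteq> A \<otimes>\<^bsub>operator_algebra X\<^esub> T \<otimes>\<^bsub>operator_algebra X\<^esub> B}"
    and "unique_maximal_ideal (singular_operators X) (operator_algebra X)"
proof -
  have eq: "singular_operators X = {T \<in> bounded_operators X. \<not> identity_factors_through T}"
    unfolding singular_operators_def operator_algebra_simps
    by (rule Collect_cong) (simp add: bounded_below_on_copy_iff cong: conj_cong)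
  show *: "singular_operators X =
      {T \<in> carrier (operator_algebra X).
        \<forall>A\<in>carrier (operator_algebra X). \<forall>B\<in>carrier (operator_algebra X).
          \<one>\<^bsub>operator_algebra X\<^esub> \<noteq> A \<otimes>\<^bsub>operator_algebra X\<^esub> T \<otimes>\<^bsub>operator_algebra X\<^esub> B}"
    unfolding eq identity_factors_through_def operator_algebra_simps by (rule Collect_cong) blast
  show "unique_maximal_ideal (singular_operators X) (operator_algebra X)"
    unfolding *
  proof (rule unique_maximal_ideal_of_nonfactors[OF ring_operator_algebra]; (unfold *[symmetric])?)
    have "norm (unit_vector undefined :: ('i, 'k) linf) \<noteq> norm (0 :: ('i, 'k) linf)"
      by simp
    then show "\<one>\<^bsub>operator_algebra X\<^esub> \<noteq> \<zero>\<^bsub>operator_algebra X\<^esub>"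
      using unit_vector_mem by (metis operator_algebra_simps(4,5) restrict_apply')
  next
    fix S T assume "S \<in> singular_operators X" "T \<in> singular_operators X"
    then show "S \<oplus>\<^bsub>operator_algebra X\<^esub> T \<in> singular_operators X"
      using identity_factors_through_summand[of S T] sum_mem[of S T]
      unfolding eq operator_algebra_simps by blast
  qed
qed

end

theorem theorem1p1:
  assumes "infinite (UNIV :: 'i set)"
  shows
    "(\<forall>X :: ('i, real) linf set. X = ell_inf \<or> X = ell_inf_c \<longrightarrow>
        singular_operators X =
          {T \<in> carrier (operator_algebra X).
            \<forall>A\<in>carrier (operator_algebra X). \<forall>B\<in>carrier (operator_algebra X).
              \<one>\<^bsub>operator_algebra X\<^esub> \<noteq> A \<otimes>\<^bsub>operator_algebra X\<^esub> T \<otimes>\<^bsub>operator_algebra X\<^esub> B}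
        \<and> unique_maximal_ideal (singular_operators X) (operator_algebra X))
     \<and>
     (\<forall>X :: ('i, complex) linf set. X = ell_inf \<or> X = ell_inf_c \<longrightarrow>
        singular_operators X =
          {T \<in> carrier (operator_algebra X).
            \<forall>A\<in>carrier (operator_algebra X). \<forall>B\<in>carrier (operator_algebra X).
              \<one>\<^bsub>operator_algebra X\<^esub> \<noteq> A \<otimes>\<^bsub>operator_algebra X\<^esub> T \<otimes>\<^bsub>operator_algebra X\<^esub> B}
        \<and> unique_maximal_ideal (singular_operators X) (operator_algebra X))"
proof -
  note both = coordinate_space_ell_inf[OF assms] coordinate_space_ell_inf_c[OF assms]
  note facts = coordinate_space.singular_operators_unique_maximal_ideal
  show ?thesis
    by (intro conjI allI impI; elim disjE) (use both[THEN facts(1)] both[THEN facts(2)] in simp_all)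
qed

end
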